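(* Let $\mu$ be a non-decreasing real-valued function on $[0,1]$ (the spectral function, equivalently a finite positive Borel measure $d\mu$ on $[0,1]$), taking either infinitely many or finitely many different values for $z\in[0,1]$, and let $$F(s)=\int_0^1\frac{1}{s-z}\,d\mu(z),\qquad s\in\mathbb{C}\setminus[0,1].$$ Then for every integer $M\ge 1$ there exists a nonstandard Padé approximant of $F$ of the form $$F(s)\simeq\frac{a(s)}{b(s)}=\frac{a_0+a_1 s+a_2s^2+\cdots+a_{M-1}s^{M-1}}{b_0+b_1 s+b_2 s^2+\cdots+b_M s^M},\qquad b_1\neq 0 .$$
   Context: Here $a_0,\dots,a_{M-1},b_0,\dots,b_M$ are real coefficients (leading coefficients are allowed to vanish). The approximation relation $F(s)\simeq a(s)/b(s)$ means the accuracy-through-order property at $s=\infty$: writing $\xi=-1/s$ and $G(\xi):=F(-1/\xi)=-\xi\int_0^1\frac{d\mu(z)}{1+z\xi}$ (analytic near $\xi=0$), the rational function $a(s)/b(s)$, expressed in the variable $\xi$, is the $[M/M]$ Padé approximant of $G$, i.e. it agrees with $G(\xi)$ up to $O(\xi^{2M+1})$ as $\xi\to 0$; equivalently, $$F(s)-\frac{a(s)}{b(s)}=O\!\left(s^{-(2M+1)}\right)\quad\text{as } |s|\to\infty .$$ The approximant is called nonstandard because it is the coefficient $b_1$ of the power-one term of the denominator (rather than $b_0$) that is required to be nonzero, so that $b_1$ can be normalized to $1$. *)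

theory Defs
  imports "HOL-Analysis.Analysis" "HOL-Library.Landau_Symbols"
begin

(* A non-decreasing function on [0,1] need not be right-continuous, but interval_measure
   expects a right-continuous function on the whole line.  So mu is replaced by its right limit
   mu(x+) = inf {mu y | x < y <= 1} on [0,1) and extended by mu 0 on the left of 0 and by mu 1 on
   the right of 1.  The resulting measure dmu has mass mu(x+) - mu(x-) at an interior point x,
   mu(0+) - mu 0 at 0 and mu 1 - mu(1-) at 1, and therefore integrates continuous functions
   on [0,1] as the Riemann-Stieltjes integral against mu does. *)
definition stieltjes_normalization :: "(real \<Rightarrow> real) \<Rightarrow> real \<Rightarrow> real" where
  "stieltjes_normalization \<mu> x =
     (if x < 0 then \<mu> 0 else if x < 1 then Inf (\<mu> ` {x<..1}) else \<mu> 1)"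

definition stieltjes_measure :: "(real \<Rightarrow> real) \<Rightarrow> real measure" where
  "stieltjes_measure \<mu> = interval_measure (stieltjes_normalization \<mu>)"

definition rational_form :: "(nat \<Rightarrow> real) \<Rightarrow> (nat \<Rightarrow> real) \<Rightarrow> nat \<Rightarrow> complex \<Rightarrow> complex" where
  "rational_form a b M s =
     (\<Sum>k<M. of_real (a k) * s ^ k) / (\<Sum>k\<le>M. of_real (b k) * s ^ k)"

definition accurate_through_order_at_infinity ::
    "(complex \<Rightarrow> complex) \<Rightarrow> (complex \<Rightarrow> complex) \<Rightarrow> nat \<Rightarrow> bool" where
  "accurate_through_order_at_infinity F R M \<longleftrightarrow>
     (\<lambda>s. F s - R s) \<in> O[at_infinity](\<lambda>s. 1 / s ^ (2 * M + 1))"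

lemma mono_stieltjes_normalization:
  assumes "mono_on {0..1} \<mu>" "x \<le> y"
  shows "stieltjes_normalization \<mu> x \<le> stieltjes_normalization \<mu> y"
proof -
  have mono: "\<mu> u \<le> \<mu> v" if "0 \<le> u" "u \<le> v" "v \<le> 1" for u v
    using assms(1) that by (auto simp: mono_on_def)
  have bdd: "bdd_below (\<mu> ` {u<..1})" if "0 \<le> u" for u
    using that mono by (intro bdd_belowI2[where m = "\<mu> 0"]) auto
  have lower: "\<mu> 0 \<le> Inf (\<mu> ` {u<..1})" if "0 \<le> u" "u < 1" for u
    using that mono by (intro cINF_greatest) auto
  have upper: "Inf (\<mu> ` {u<..1}) \<le> \<mu> 1" if "0 \<le> u" "u < 1" for u
    using that by (intro cINF_lower bdd) auto
  have step: "Inf (\<mu> ` {x<..1}) \<le> Inf (\<mu> ` {y<..1})" if "0 \<le> x" "y < 1"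
    using that assms(2) by (intro cInf_superset_mono bdd) auto
  show ?thesis
    using assms(2) lower[of y] upper[of x] step mono[of 0 1]
    by (auto simp: stieltjes_normalization_def)
qed

lemma right_continuous_stieltjes_normalization:
  assumes "mono_on {0..1} \<mu>"
  shows "continuous (at_right x) (stieltjes_normalization \<mu>)"
proof -
  let ?g = "stieltjes_normalization \<mu>"
  have mono: "\<mu> u \<le> \<mu> v" if "0 \<le> u" "u \<le> v" "v \<le> 1" for u v
    using assms that by (auto simp: mono_on_def)
  have bdd: "bdd_below (\<mu> ` {u<..1})" if "0 \<le> u" for u
    using that mono by (intro bdd_belowI2[where m = "\<mu> 0"]) auto
  consider "x < 0" | "0 \<le> x" "x < 1" | "1 \<le> x" by linarith
  then have "(?g \<longlongrightarrow> ?g x) (at_right x)"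
  proof cases
    case 1
    have "eventually (\<lambda>y. ?g y = ?g x) (at_right x)"
      unfolding eventually_at_right[OF 1] using 1
      by (auto simp: stieltjes_normalization_def intro!: exI[of _ 0])
    then show ?thesis by (rule tendsto_eventually)
  next
    case 2
    show ?thesis
    proof (rule order_tendstoI)
      fix c assume c: "c < ?g x"
      show "eventually (\<lambda>y. c < ?g y) (at_right x)"
        using c mono_stieltjes_normalization[OF assms]
        by (auto simp: eventually_at_right_field intro!: exI[of _ "x + 1"] less_le_trans[OF c])
    next
      fix c assume "?g x < c"
      then have "Inf (\<mu> ` {x<..1}) < c"
        using 2 by (simp add: stieltjes_normalization_def)
      then obtain z where z: "x < z" "z \<le> 1" "\<mu> z < c"
        using cInf_lessD[of "\<mu> ` {x<..1}" c] 2 by auto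
      have "?g y < c" if "x < y" "y < z" for y
      proof -
        have "Inf (\<mu> ` {y<..1}) \<le> \<mu> z"
          using that z 2 by (intro cINF_lower bdd) auto
        then show ?thesis using that z 2 by (simp add: stieltjes_normalization_def)
      qed
      then show "eventually (\<lambda>y. ?g y < c) (at_right x)"
        using z by (auto simp: eventually_at_right_field)
    qed
  next
    case 3
    have "eventually (\<lambda>y. ?g y = ?g x) (at_right x)"
      using 3 by (auto simp: stieltjes_normalization_def eventually_at_right_field
          intro!: exI[of _ "x + 1"])
    then show ?thesis by (rule tendsto_eventually)
  qed
  then show ?thesis by (simp add: continuous_within)
qed

lemma emeasure_stieltjes_measure_Ioc:
  assumes "mono_on {0..1} \<mu>" "c \<le> d"
  shows "emeasure (stieltjes_measure \<mu>) {c<..d} =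
    ennreal (stieltjes_normalization \<mu> d - stieltjes_normalization \<mu> c)"
  unfolding stieltjes_measure_def
  by (rule emeasure_interval_measure_Ioc[OF assms(2) mono_stieltjes_normalization[OF assms(1)]
        right_continuous_stieltjes_normalization[OF assms(1)]])

(* The variable xi = -1/s turns accuracy at infinity into agreement with G(xi) = F(-1/xi)
   up to O(xi^(2M+1)), the usual condition on an [M/M] Pade approximant of G. *)
lemma accurate_through_order_at_infinity_iff_Pade_at_zero:
  "accurate_through_order_at_infinity F R M \<longleftrightarrow>
     (\<lambda>\<xi>. F (- 1 / \<xi>) - R (- 1 / \<xi>)) \<in> O[at 0](\<lambda>\<xi>. \<xi> ^ (2 * M + 1))"
proof -
  have ev: "eventually P at_infinity \<longleftrightarrow> eventually (\<lambda>\<xi>. P (- 1 / \<xi>)) (at 0)"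
    for P :: "complex \<Rightarrow> bool"
  proof
    have "((\<lambda>\<xi>::complex. - \<xi>) \<longlongrightarrow> 0) (at 0)"
      by (auto intro!: tendsto_eq_intros)
    then have "filterlim (\<lambda>\<xi>::complex. - \<xi>) (at 0) (at 0)"
      by (auto simp: filterlim_at eventually_at_filter)
    then have "filterlim (\<lambda>\<xi>::complex. inverse (- \<xi>)) at_infinity (at 0)"
      by (rule filterlim_compose[OF filterlim_inverse_at_infinity])
    then show "eventually P at_infinity \<Longrightarrow> eventually (\<lambda>\<xi>. P (- 1 / \<xi>)) (at 0)"
      by (auto simp: filterlim_iff divide_inverse)
  next
    assume *: "eventually (\<lambda>\<xi>. P (- 1 / \<xi>)) (at 0)"
    have "filterlim (\<lambda>s::complex. inverse (- s)) (at 0) at_infinity"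
      unfolding filterlim_inverse_at_iff
      by (simp add: filterlim_at_infinity_conv_norm_at_top filterlim_norm_at_top)
    then have "eventually (\<lambda>s. P (- 1 / inverse (- s))) at_infinity"
      using * unfolding filterlim_iff by blast
    then show "eventually P at_infinity" by (simp add: divide_inverse)
  qed
  show ?thesis
    unfolding accurate_through_order_at_infinity_def bigo_def
    by (simp add: ev norm_divide norm_power power_divide)
qed

end

theory Submission
  imports Defs
begin

text \<open>
  Let $p_n$ and $k_n$ be the monic orthogonal polynomials for $d\mu$ and $z\,d\mu$. They satisfy
  $p_{n+1} = z k_n - \alpha_n p_n$ and $k_{n+1} = p_{n+1} - \beta_n k_n$ with $\alpha_n > 0$ and
  $\beta_n \ge 0$, so the signs of $(-1)^n p_n(0) > 0$, $(-1)^n k_n(0) > 0$ and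
  $(-1)^n p_n'(0) < 0$ propagate without any knowledge of the roots. Hence $p_M$ is a denominator
  with $b_1 \ne 0$. If the recursion breaks down because $p_n$ or $z k_n$ vanishes
  $\mu$-almost everywhere, that polynomial (or $z$ itself, when $\mu = 0$) is a denominator for
  which the approximation is exact.

  For a denominator $q$ with numerator $a$ the error is $q F - a = \int q(z)/(s-z)\,d\mu$, and
  each orthogonality relation $\int z^j q\,d\mu = 0$ gains one factor $1/s$.
\<close>

section \<open>Linear functionals on polynomials that are nonnegative on squares\<close>

locale positive_functional =
  fixes L :: "real poly \<Rightarrow> real"
  assumes add: "L (p + q) = L p + L q"
    and smult: "L (smult c p) = c * L p"
    and square_nonneg: "0 \<le> L (p * p)"
begin

lemma diff: "L (p - q) = L p - L q"
  using add[of "p - q" q] by simp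

lemma zero: "L 0 = 0"
  using smult[of 0 0] by simp

text \<open>Degenerate Cauchy-Schwarz: when L (p * p) = 0, the square of t p + q has a value affine
  in t, which stays nonnegative for all t only if the slope 2 L (p * q) is zero.\<close>

lemma null_square_imp_orthogonal:
  assumes "L (p * p) = 0"
  shows "L (p * q) = 0"
proof (rule ccontr)
  assume *: "L (p * q) \<noteq> 0"
  \<comment> \<open>Solves 2 t L (p * q) + L (q * q) = -1.\<close>
  define t where "t = - (L (q * q) + 1) / (2 * L (p * q))"
  have "(smult t p + q) * (smult t p + q) =
      smult (t\<^sup>2) (p * p) + (smult t (p * q) + (smult t (p * q) + q * q))"
    by (simp add: algebra_simps power2_eq_square)
  then have "L ((smult t p + q) * (smult t p + q)) = 2 * t * L (p * q) + L (q * q)"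
    using assms by (simp only: add smult)
  also have "\<dots> = -1"
    using * by (simp add: t_def field_simps)
  finally show False
    using square_nonneg[of "smult t p + q"] by simp
qed

text \<open>Subtracting the right multiple of the monic p from q leaves a remainder of degree below
  n, which p annihilates. So pairing p with degree at most n sees only the top coefficient.\<close>

lemma orthogonal_eq_coeff:
  assumes "degree p = n" "coeff p n = 1"
    and orth: "\<And>q. degree q < n \<Longrightarrow> L (p * q) = 0"
    and "degree q \<le> n"
  shows "L (p * q) = coeff q n * L (p * p)"
proof -
  define r where "r = q - smult (coeff q n) p"
  have "degree r \<le> n"
    using assms(1,4) by (auto simp: r_def intro!: degree_diff_le)
  moreover have "coeff r n = 0"
    using assms(2) by (simp add: r_def)
  \<comment> \<open>The case r = 0 stands apart because for n = 0 its degree 0 is not below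
    n.\<close>
  ultimately have "degree r < n \<or> r = 0"
    using eq_zero_or_degree_less by blast
  then have "L (p * r) = 0"
    using orth zero by auto
  then show ?thesis
    by (simp add: r_def right_diff_distrib diff smult)
qed

end

section \<open>Coupled orthogonal polynomials for a functional L and its shift q -> L (z q)\<close>

locale stieltjes_functional = positive_functional L +
  shifted: positive_functional "\<lambda>q. L (pCons 0 q)" for L
begin

text \<open>The sign conditions are those of monic polynomials with positive roots only, stated
  without roots. At n = 0 the polynomial p = 1 has no linear term, so the strict sign of p'(0)
  starts at n = 1.\<close>

definition orthogonal_pair :: "nat \<Rightarrow> real poly \<Rightarrow> real poly \<Rightarrow> bool" where
  "orthogonal_pair n p k \<longleftrightarrow>
     degree p = n \<and> coeff p n = 1 \<and> (\<forall>q. degree q < n \<longrightarrow> L (p * q) = 0) \<and>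
     degree k = n \<and> coeff k n = 1 \<and> (\<forall>q. degree q < n \<longrightarrow> L (pCons 0 (k * q)) = 0) \<and>
     (- 1) ^ n * coeff p 0 > 0 \<and> (- 1) ^ n * coeff k 0 > 0 \<and>
     (if n = 0 then coeff p 1 = 0 else (- 1) ^ n * coeff p 1 < 0)"

lemma orthogonal_pair_step:
  assumes "orthogonal_pair n p k"
    and pi: "L (p * p) > 0" and kappa: "L (pCons 0 (k * k)) > 0"
  shows "\<exists>p' k'. orthogonal_pair (Suc n) p' k'"
proof -
  from assms(1) have p: "degree p = n" "coeff p n = 1" "\<And>q. degree q < n \<Longrightarrow> L (p * q) = 0"
    and k: "degree k = n" "coeff k n = 1" "\<And>q. degree q < n \<Longrightarrow> L (pCons 0 (k * q)) = 0"
    and signs: "(- 1) ^ n * coeff p 0 > 0" "(- 1) ^ n * coeff k 0 > 0"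
      "(- 1) ^ n * coeff p 1 \<le> 0"
    by (auto simp: orthogonal_pair_def split: if_splits)
  \<comment> \<open>Up to degree n, both L (z k q) and L (p q) are multiples of
    \<open>coeff q n\<close>; \<alpha> is the ratio that cancels them. One degree higher, \<beta>
    plays the same part for \<open>k'\<close>.\<close>
  define \<alpha> where "\<alpha> = L (pCons 0 (k * k)) / L (p * p)"
  define p' where "p' = pCons 0 k - smult \<alpha> p"
  define \<beta> where "\<beta> = L (p' * p') / L (pCons 0 (k * k))"
  define k' where "k' = p' - smult \<beta> k"
  have \<alpha>: "\<alpha> > 0"
    using pi kappa by (simp add: \<alpha>_def)
  have \<beta>: "\<beta> \<ge> 0"
    using kappa square_nonneg by (simp add: \<beta>_def)
  have p'_deg: "degree p' = Suc n" "coeff p' (Suc n) = 1"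
  proof -
    show "coeff p' (Suc n) = 1"
      using p k by (simp add: p'_def coeff_eq_0)
    then show "degree p' = Suc n"
      using p k by (intro antisym le_degree) (auto simp: p'_def intro!: degree_diff_le
          order_trans[OF degree_pCons_le])
  qed
  have k'_deg: "degree k' = Suc n" "coeff k' (Suc n) = 1"
  proof -
    show "coeff k' (Suc n) = 1"
      using p'_deg k by (simp add: k'_def coeff_eq_0)
    then show "degree k' = Suc n"
      using p'_deg k by (intro antisym le_degree) (auto simp: k'_def intro!: degree_diff_le)
  qed
  have p'_orth: "L (p' * q) = 0" if "degree q < Suc n" for q
  proof -
    have "L (p' * q) = L (pCons 0 (k * q)) - \<alpha> * L (p * q)"
      by (simp add: p'_def left_diff_distrib diff smult)
    also have "\<dots> = coeff q n * L (pCons 0 (k * k)) - \<alpha> * (coeff q n * L (p * p))"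
      using that shifted.orthogonal_eq_coeff[OF k] orthogonal_eq_coeff[OF p] by simp
    also have "\<dots> = 0"
      using pi by (simp add: \<alpha>_def)
    finally show ?thesis .
  qed
  have k'_orth: "L (pCons 0 (k' * q)) = 0" if "degree q < Suc n" for q
  proof -
    \<comment> \<open>The factor z is moved onto q in the p' term: z q has degree at most n + 1 and
      its coefficient there is \<open>coeff q n\<close>.\<close>
    have eq: "pCons 0 (k' * q) = p' * pCons 0 q - smult \<beta> (pCons 0 (k * q))"
      by (simp add: k'_def left_diff_distrib)
    have "degree (pCons 0 q) \<le> Suc n"
      using that by (intro order_trans[OF degree_pCons_le]) simp
    then have "L (p' * pCons 0 q) = coeff q n * L (p' * p')"
      using orthogonal_eq_coeff[OF p'_deg p'_orth, of "pCons 0 q"] by simp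
    moreover have "L (pCons 0 (k * q)) = coeff q n * L (pCons 0 (k * k))"
      using that shifted.orthogonal_eq_coeff[OF k] by simp
    ultimately show ?thesis
      using kappa unfolding eq diff smult by (simp add: \<beta>_def)
  qed
  have p'_0: "(- 1) ^ Suc n * coeff p' 0 = \<alpha> * ((- 1) ^ n * coeff p 0)"
    by (simp add: p'_def)
  have p'_1: "(- 1) ^ Suc n * coeff p' 1 = \<alpha> * ((- 1) ^ n * coeff p 1) - (- 1) ^ n * coeff k 0"
    by (simp add: p'_def algebra_simps)
  have k'_0: "(- 1) ^ Suc n * coeff k' 0 =
      (- 1) ^ Suc n * coeff p' 0 + \<beta> * ((- 1) ^ n * coeff k 0)"
    by (simp add: k'_def algebra_simps)
  have s1: "(- 1) ^ Suc n * coeff p' 0 > 0"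
    unfolding p'_0 using \<alpha> signs by simp
  have s2: "(- 1) ^ Suc n * coeff k' 0 > 0"
    unfolding k'_0 by (intro add_pos_nonneg[OF s1] mult_nonneg_nonneg \<beta> less_imp_le signs)
  \<comment> \<open>Strictness comes from the k(0) term, so it holds even for n = 0, where the
    linear coefficient of p is zero.\<close>
  have s3: "(- 1) ^ Suc n * coeff p' 1 < 0"
    unfolding p'_1 using mult_nonneg_nonpos[of \<alpha>] \<alpha> signs(2,3) by fastforce
  have "orthogonal_pair (Suc n) p' k'"
    unfolding orthogonal_pair_def using p'_deg k'_deg p'_orth k'_orth s1 s2 s3 by auto
  then show ?thesis by blast
qed

text \<open>The recursion can stop only when p or k has norm zero in its own functional; then p or z
  k is orthogonal to everything, and the sign conditions keep its linear coefficient nonzero. Since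
  the degree is only bounded by n, a null polynomial once found serves all later n.\<close>

lemma null_polynomial_or_orthogonal_pair:
  "(\<exists>q. degree q \<le> n \<and> coeff q 1 \<noteq> 0 \<and> (\<forall>r. L (q * r) = 0)) \<or> (\<exists>p k. orthogonal_pair n p k)"
proof (induction n)
  case 0
  have "orthogonal_pair 0 1 1"
    by (simp add: orthogonal_pair_def)
  then show ?case by blast
next
  case (Suc n)
  then consider q where "degree q \<le> n" "coeff q 1 \<noteq> 0" "\<And>r. L (q * r) = 0"
    | p k where "orthogonal_pair n p k" by blast
  then show ?case
  proof cases
    case 1
    then show ?thesis by (meson le_SucI)
  next
    case pair: 2
    consider "L (p * p) = 0" | "L (pCons 0 (k * k)) = 0"
      | "L (p * p) > 0" "L (pCons 0 (k * k)) > 0"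
      using square_nonneg[of p] shifted.square_nonneg[of k] by linarith
    then show ?thesis
    proof cases
      case 1
      then have null: "L (p * r) = 0" for r
        by (rule null_square_imp_orthogonal)
      show ?thesis
      \<comment> \<open>For n = 0 the null polynomial is 1, which has no linear term; L then
        vanishes identically, and z can replace it.\<close>
      proof (cases "n = 0")
        case True
        then have "p = 1"
          using pair by (auto simp: orthogonal_pair_def elim: degree_eq_zeroE)
        then have "L ([:0, 1:] * r) = 0" for r
          using null by simp
        then have "degree [:0, 1 :: real:] \<le> Suc n \<and> coeff [:0, 1 :: real:] 1 \<noteq> 0 \<and>
            (\<forall>r. L ([:0, 1:] * r) = 0)" by simp
        then show ?thesis by blast
      next
        case False
        then have "degree p \<le> Suc n \<and> coeff p 1 \<noteq> 0 \<and> (\<forall>r. L (p * r) = 0)"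
          using pair null by (auto simp: orthogonal_pair_def)
        then show ?thesis by blast
      qed
    next
      case 2
      \<comment> \<open>The linear coefficient of z k is k(0), nonzero by its sign.\<close>
      then have "L (pCons 0 k * r) = 0" for r
        using shifted.null_square_imp_orthogonal by simp
      moreover have "degree (pCons 0 k) \<le> Suc n" "coeff (pCons 0 k) 1 \<noteq> 0"
        using pair by (auto simp: orthogonal_pair_def intro: order_trans[OF degree_pCons_le])
      ultimately show ?thesis by blast
    next
      case 3
      then show ?thesis
        using orthogonal_pair_step[OF pair] by blast
    qed
  qed
qed

text \<open>Dividing by q contributes \<open>degree q\<close> orders of decay, so 2 M -
  \<open>degree q\<close> orthogonality relations suffice. A regular q of degree M has exactly M of
  them; a null q of lower degree has them all.\<close>

lemma exists_nonstandard_denominator: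
  assumes "M \<ge> 1"
  shows "\<exists>q. degree q \<le> M \<and> coeff q 1 \<noteq> 0 \<and>
           (\<forall>r. degree r < 2 * M - degree q \<longrightarrow> L (q * r) = 0)"
  using null_polynomial_or_orthogonal_pair[of M] assms
  by (fastforce simp: orthogonal_pair_def)

end

section \<open>Real polynomials at complex arguments and their growth at infinity\<close>

abbreviation cpoly :: "real poly \<Rightarrow> complex \<Rightarrow> complex" where
  "cpoly q \<equiv> poly (map_poly complex_of_real q)"

lemma cpoly_altdef:
  assumes "degree q \<le> n"
  shows "cpoly q s = (\<Sum>k\<le>n. of_real (coeff q k) * s ^ k)"
proof -
  have "cpoly q s = (\<Sum>k\<le>degree q. of_real (coeff q k) * s ^ k)"
    by (simp add: poly_altdef coeff_map_poly degree_map_poly)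
  also have "\<dots> = (\<Sum>k\<le>n. of_real (coeff q k) * s ^ k)"
    using assms by (intro sum.mono_neutral_left) (auto simp: coeff_eq_0)
  finally show ?thesis .
qed

lemma inverse_poly_bigo:
  fixes q :: "'a :: real_normed_field poly"
  assumes "q \<noteq> 0"
  shows "(\<lambda>s. 1 / poly q s) \<in> O[at_infinity](\<lambda>s. 1 / s ^ degree q)"
proof (rule bigoI_tendsto)
  have "((\<lambda>s. inverse (poly q s / s ^ degree q)) \<longlongrightarrow> inverse (lead_coeff q)) at_infinity"
    using assms by (intro tendsto_inverse poly_divide_tendsto_aux) simp
  then show "((\<lambda>s. (1 / poly q s) / (1 / s ^ degree q)) \<longlongrightarrow> inverse (lead_coeff q)) at_infinity"
    by (simp add: field_simps)
  show "eventually (\<lambda>s :: 'a. 1 / s ^ degree q \<noteq> 0) at_infinity"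
    using eventually_not_equal_at_infinity[of 0] by eventually_elim simp
qed

section \<open>Moments and Cauchy transforms of a measure on the unit interval\<close>

locale unit_interval_measure =
  fixes N :: "real measure"
  assumes sets [simp, measurable_cong]: "sets N = sets borel"
    and finite: "emeasure N {0..1} < \<infinity>"
begin

lemma integrable_continuous:
  fixes f :: "real \<Rightarrow> 'a :: {banach, second_countable_topology}"
  assumes "continuous_on {0..1} f"
  shows "set_integrable N {0..1} f"
proof -
  have "compact (f ` {0..1})"
    using assms by (intro compact_continuous_image) auto
  then obtain B where B: "\<And>x. x \<in> {0..1} \<Longrightarrow> norm (f x) \<le> B"
    by (meson bounded_iff compact_imp_bounded imageI)
  have "(\<lambda>x. indicator {0..1} x *\<^sub>R f x) \<in> borel_measurable borel"
    using assms by (rule borel_measurable_continuous_on_indicator[rotated]) simp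
  then have meas: "(\<lambda>x. indicator {0..1} x *\<^sub>R f x) \<in> borel_measurable N"
    by (simp cong: measurable_cong_sets)
  show ?thesis
    unfolding set_integrable_def
    by (rule integrableI_bounded_set[where A = "{0..1}" and B = B])
      (use finite B meas in \<open>auto simp: indicator_def\<close>)
qed

definition moment :: "real poly \<Rightarrow> real" where
  "moment q = (LINT z:{0..1}|N. poly q z)"

lemma integrable_poly: "set_integrable N {0..1} (poly q)"
  by (intro integrable_continuous continuous_intros)

lemma moment_nonneg:
  assumes "\<And>z. z \<in> {0..1} \<Longrightarrow> poly q z \<ge> 0"
  shows "moment q \<ge> 0"
  unfolding moment_def set_lebesgue_integral_def
  using assms by (intro integral_nonneg_AE) (auto simp: indicator_def)

text \<open>Restricting the integrals to [0,1] makes z p(z)^2 nonnegative, which gives the shifted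
  positivity.\<close>

sublocale stieltjes_functional moment
proof
  show add: "moment (p + q) = moment p + moment q" for p q
    by (simp add: moment_def integrable_poly set_integral_add)
  show smult: "moment (smult c p) = c * moment p" for c p
    by (simp add: moment_def)
  show "0 \<le> moment (p * p)" for p
    by (rule moment_nonneg) simp
  show "0 \<le> moment (pCons 0 (p * p))" for p
    by (rule moment_nonneg) simp
  show "moment (pCons 0 (p + q)) = moment (pCons 0 p) + moment (pCons 0 q)" for p q
    using add[of "pCons 0 p" "pCons 0 q"] by simp
  show "moment (pCons 0 (smult c p)) = c * moment (pCons 0 p)" for c p
    using smult[of c "pCons 0 p"] by simp
qed

text \<open>\<open>cauchy 1\<close> is F itself. For a denominator q this is the function of the
  second kind, which will be the linearised error q F - a.\<close>

definition cauchy :: "real poly \<Rightarrow> complex \<Rightarrow> complex" where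
  "cauchy q s = (LINT z:{0..1}|N. of_real (poly q z) / (s - of_real z))"

lemma cauchy_integrable:
  assumes "s \<notin> of_real ` {0..1}"
  shows "set_integrable N {0..1} (\<lambda>z. of_real (poly q z) / (s - of_real z) :: complex)"
  using assms by (intro integrable_continuous continuous_intros) auto

text \<open>Integrates z / (s - z) = s / (s - z) - 1 against q: one Horner step for the
  transform.\<close>

lemma cauchy_pCons:
  assumes s: "s \<notin> of_real ` {0..1}"
  shows "cauchy (pCons c q) s = of_real c * cauchy 1 s + s * cauchy q s - of_real (moment q)"
proof -
  have "cauchy (pCons c q) s =
    (LINT z:{0..1}|N. of_real c * (of_real (poly 1 z) / (s - of_real z)) +
       s * (of_real (poly q z) / (s - of_real z)) - of_real (poly q z))"
    unfolding cauchy_def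
  proof (rule set_lebesgue_integral_cong; safe?)
    fix z :: real assume "z \<in> {0..1}"
    with s obtain d where "s = d + of_real z" "d \<noteq> 0"
      by (metis diff_add_cancel eq_iff_diff_eq_0 imageI)
    then show "of_real (poly (pCons c q) z) / (s - of_real z) =
        of_real c * (of_real (poly 1 z) / (s - of_real z)) +
        s * (of_real (poly q z) / (s - of_real z)) - of_real (poly q z)"
      by (simp add: field_simps)
  qed simp
  also have "\<dots> = of_real c * cauchy 1 s + s * cauchy q s - of_real (moment q)"
  proof -
    have "set_integrable N {0..1} (\<lambda>z. of_real (poly q z) :: complex)"
      by (intro integrable_continuous continuous_intros)
    then show ?thesis
      by (simp only: set_integral_add set_integral_diff set_integral_mult_right
          set_integral_complex_of_real set_integrable_mult_right cauchy_integrable[OF s]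
          cauchy_def moment_def)
  qed
  finally show ?thesis .
qed

text \<open>Horner recursion on q builds the associated polynomial a(s), the integral of (q(s) -
  q(z)) / (s - z). Its degree bound is stated through coefficients so that a constant q forces a =
  0.\<close>

lemma cauchy_eq_numerator:
  "\<exists>a. (\<forall>k\<ge>degree q. coeff a k = 0) \<and>
     (\<forall>s. s \<notin> of_real ` {0..1} \<longrightarrow> cauchy q s = cpoly q s * cauchy 1 s - cpoly a s)"
proof (induction q)
  case 0
  show ?case by (intro exI[of _ 0]) (simp add: cauchy_def)
next
  case (pCons c q)
  then obtain a where a: "\<And>k. k \<ge> degree q \<Longrightarrow> coeff a k = 0"
    "\<And>s. s \<notin> of_real ` {0..1} \<Longrightarrow> cauchy q s = cpoly q s * cauchy 1 s - cpoly a s"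
    by blast
  show ?case
  proof (intro exI[of _ "pCons (moment q) a"] conjI allI impI)
    fix k assume k: "k \<ge> degree (pCons c q)"
    show "coeff (pCons (moment q) a) k = 0"
    proof (cases "q = 0")
      case True
      then have "a = 0"
        using a(1) by (intro poly_eqI) simp
      then show ?thesis
        using True by (simp add: zero)
    next
      case False
      then show ?thesis
        using k a(1) by (cases k) auto
    qed
  next
    fix s :: complex assume "s \<notin> of_real ` {0..1}"
    then show "cauchy (pCons c q) s =
        cpoly (pCons c q) s * cauchy 1 s - cpoly (pCons (moment q) a) s"
      by (simp add: cauchy_pCons a(2) map_poly_pCons algebra_simps)
  qed
qed

text \<open>Each vanishing moment removes the constant term in \<open>cauchy_pCons\<close>. Read
  from right to left, the K relations give \<open>cauchy q\<close> a factor s^(-K) times a transform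
  that is still O(1/s).\<close>

lemma cauchy_eq_monom_mult:
  assumes "\<And>r. degree r < K \<Longrightarrow> moment (q * r) = 0"
    and s: "s \<notin> of_real ` {0..1}"
  shows "cauchy (monom 1 K * q) s = s ^ K * cauchy q s"
  using assms(1)
proof (induction K)
  case (Suc K)
  have "moment (monom 1 K * q) = 0"
    using Suc.prems[of "monom 1 K"] by (simp add: degree_monom_eq mult.commute)
  moreover have "monom 1 (Suc K) * q = pCons 0 (monom 1 K * q)"
    by (simp add: monom_Suc)
  ultimately show ?case
    using Suc by (simp add: cauchy_pCons[OF s])
qed simp

lemma cauchy_bigo: "cauchy q \<in> O[at_infinity](\<lambda>s. 1 / s)"
proof (rule bigoI)
  define C where "C = (LINT z:{0..1}|N. \<bar>poly q z\<bar>)"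
  have "norm (cauchy q s) \<le> (2 * C) * norm (1 / s)" if s: "2 \<le> norm s" for s
  proof -
    \<comment> \<open>For z in [0,1] the distance is at least |s| - 1, and |s| >= 2 makes this at
      least |s| / 2.\<close>
    have dist: "norm s / 2 \<le> norm (s - of_real z)" if "z \<in> {0..1}" for z
      using norm_triangle_ineq2[of s "of_real z"] that s by simp
    then have "s \<notin> of_real ` {0..1}"
      using s by fastforce
    then have int: "set_integrable N {0..1} (\<lambda>z. of_real (poly q z) / (s - of_real z) :: complex)"
      by (rule cauchy_integrable)
    have "norm (cauchy q s) \<le>
        (LINT z:{0..1}|N. norm (of_real (poly q z) / (s - of_real z) :: complex))"
      unfolding cauchy_def by (rule set_integral_norm_bound[OF int])
    also have "\<dots> \<le> (LINT z:{0..1}|N. \<bar>poly q z\<bar> * (2 / norm s))"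
    proof (rule set_integral_mono)
      show "set_integrable N {0..1} (\<lambda>z. norm (of_real (poly q z) / (s - of_real z) :: complex))"
        using int by (rule set_integrable_norm)
      show "set_integrable N {0..1} (\<lambda>z. \<bar>poly q z\<bar> * (2 / norm s))"
        by (intro integrable_continuous continuous_intros) (use s in auto)
      fix z :: real assume z: "z \<in> {0..1}"
      have "\<bar>poly q z\<bar> / norm (s - of_real z) \<le> \<bar>poly q z\<bar> / (norm s / 2)"
        using dist[OF z] s by (intro divide_left_mono mult_pos_pos) auto
      then show "norm (of_real (poly q z) / (s - of_real z)) \<le> \<bar>poly q z\<bar> * (2 / norm s)"
        by (simp add: norm_divide)
    qed
    also have "\<dots> = (2 * C) * norm (1 / s)"
      by (simp add: C_def norm_divide)
    finally show ?thesis .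
  qed
  then show "eventually (\<lambda>s. norm (cauchy q s) \<le> (2 * C) * norm (1 / s)) at_infinity"
    unfolding eventually_at_infinity by blast
qed

section \<open>Assembling the approximant and its error order\<close>

theorem nonstandard_pade:
  assumes "M \<ge> 1" and F: "\<And>s. s \<notin> of_real ` {0..1} \<Longrightarrow> F s = cauchy 1 s"
  shows "\<exists>a b :: nat \<Rightarrow> real. b 1 \<noteq> 0 \<and>
           accurate_through_order_at_infinity F (rational_form a b M) M"
proof -
  obtain q where q: "degree q \<le> M" "coeff q 1 \<noteq> 0"
    "\<And>r. degree r < 2 * M - degree q \<Longrightarrow> moment (q * r) = 0"
    using exists_nonstandard_denominator[OF \<open>M \<ge> 1\<close>] by blast
  obtain a where a: "\<And>k. k \<ge> degree q \<Longrightarrow> coeff a k = 0"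
    "\<And>s. s \<notin> of_real ` {0..1} \<Longrightarrow> cauchy q s = cpoly q s * cauchy 1 s - cpoly a s"
    using cauchy_eq_numerator[of q] by blast
  define K where "K = 2 * M - degree q"
  define Q where "Q = map_poly complex_of_real q"
  have Q: "Q \<noteq> 0" "degree Q = degree q"
    using q(2) by (auto simp: Q_def degree_map_poly map_poly_eq_0_iff)
  \<comment> \<open>Since \<open>degree q\<close> is at most M, the coefficient of a at M vanishes
    and the numerator sum can stop at M - 1.\<close>
  have a_eq: "cpoly a s = (\<Sum>k<M. of_real (coeff a k) * s ^ k)" for s
  proof -
    have "degree a \<le> M"
      using a(1) q(1) by (intro degree_le) auto
    then have "cpoly a s = (\<Sum>k\<le>M. of_real (coeff a k) * s ^ k)"
      by (rule cpoly_altdef)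
    then show ?thesis
      using a(1)[OF q(1)] by (simp flip: lessThan_Suc_atMost)
  qed
  have R: "rational_form (coeff a) (coeff q) M s = cpoly a s / poly Q s" for s
    unfolding rational_form_def Q_def a_eq cpoly_altdef[OF q(1)] ..
  have "eventually (\<lambda>s. poly Q s \<noteq> 0) at_infinity"
  proof -
    obtain B where "\<And>s. poly Q s = 0 \<Longrightarrow> norm s \<le> B"
      using finite_imp_bounded[OF poly_roots_finite[OF Q(1)]] by (auto simp: bounded_iff)
    then have "\<forall>s. B + 1 \<le> norm s \<longrightarrow> poly Q s \<noteq> 0"
      by fastforce
    then show ?thesis
      unfolding eventually_at_infinity by blast
  qed
  moreover have "eventually (\<lambda>s::complex. 2 \<le> norm s) at_infinity"
    unfolding eventually_at_infinity by blast
  \<comment> \<open>The three factors have orders 1, K and \<open>degree q\<close>, which add up to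
    2 M + 1.\<close>
  ultimately have eq: "eventually (\<lambda>s. F s - rational_form (coeff a) (coeff q) M s =
      cauchy (monom 1 K * q) s * (1 / s ^ K) * (1 / poly Q s)) at_infinity"
  proof eventually_elim
    case (elim s)
    then have s: "s \<notin> of_real ` {0..1}" "s \<noteq> 0"
      by auto
    have "F s - rational_form (coeff a) (coeff q) M s = cauchy q s / poly Q s"
      using elim s by (simp add: F R a(2) flip: Q_def) (simp add: field_simps)
    then show ?case
      using s cauchy_eq_monom_mult[OF q(3) s(1)] by (simp add: K_def)
  qed
  have "(\<lambda>s. cauchy (monom 1 K * q) s * (1 / s ^ K) * (1 / poly Q s)) \<in>
      O[at_infinity](\<lambda>s. 1 / s * (1 / s ^ K) * (1 / s ^ degree Q))"
    by (intro landau_o.big.mult cauchy_bigo inverse_poly_bigo Q landau_o.big_refl)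
  also have "(\<lambda>s::complex. 1 / s * (1 / s ^ K) * (1 / s ^ degree Q)) = (\<lambda>s. 1 / s ^ (2 * M + 1))"
  proof -
    have "2 * M + 1 = Suc (K + degree Q)"
      using q(1) Q(2) by (simp add: K_def)
    then show ?thesis
      by (simp add: power_add mult.assoc)
  qed
  finally have "accurate_through_order_at_infinity F (rational_form (coeff a) (coeff q) M) M"
    unfolding accurate_through_order_at_infinity_def landau_o.big.in_cong[OF eq] .
  then show ?thesis
    using q(2) by blast
qed

end

theorem theorem3p1:
  fixes \<mu> :: "real \<Rightarrow> real" and F :: "complex \<Rightarrow> complex" and M :: nat
  assumes "mono_on {0..1} \<mu>"
    and "\<And>s. s \<in> UNIV - complex_of_real ` {0..1} \<Longrightarrow>
           F s = (LINT z:{0..1}|stieltjes_measure \<mu>. 1 / (s - complex_of_real z))"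
    and "M \<ge> 1"
  shows "\<exists>a b :: nat \<Rightarrow> real. b 1 \<noteq> 0 \<and>
           accurate_through_order_at_infinity F (rational_form a b M) M"
proof -
  have sets: "sets (stieltjes_measure \<mu>) = sets borel"
    by (simp add: stieltjes_measure_def)
  \<comment> \<open>The mass formula is for half-open intervals; starting at -1 includes a possible
    atom at 0.\<close>
  have "emeasure (stieltjes_measure \<mu>) {0..1} \<le> emeasure (stieltjes_measure \<mu>) {-1<..1}"
    by (rule emeasure_mono) (auto simp: sets)
  also have "\<dots> < \<infinity>"
    using assms(1) by (simp add: emeasure_stieltjes_measure_Ioc)
  finally interpret unit_interval_measure "stieltjes_measure \<mu>"
    using sets by unfold_locales
  show ?thesis
    using assms(2,3) by (intro nonstandard_pade) (auto simp: cauchy_def)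
qed

end
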